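(* Let $d\ge2$ and let $E\subseteq\mathbb{R}^d$ be a Borel $1$-rectifiable set satisfying $\mathcal{H}^1(E)>0$. Let $\{\varphi_\alpha\}_{\alpha\in\mathcal{A}}$ be a family of $C^2$ mappings $\varphi_\alpha:\mathbb{R}^d\to\mathbb{R}$ indexed by a topological space $\mathcal{A}$. Define $$\mathcal{B}_E:=\big\{\alpha\in\mathcal{A}:\mathcal{H}^1\big(\varphi_\alpha(E)\big)=0\big\},$$ and let $\mathfrak{G}\subseteq\mathcal{A}^d$ be the set of admissible tuples. (1) If $\mathcal{B}_E^d$ denotes the $d$-fold Cartesian product of $\mathcal{B}_E$, then $$\mathcal{B}_E^d\cap\mathfrak{G}=\emptyset.$$ (2) If $\mathcal{A}\subseteq\mathbb{R}^m$ and every affinely independent tuple $\alpha_1,\ldots,\alpha_d\in\mathcal{A}$ is admissible, then there exists an affine subspace $V_E\subseteq\mathbb{R}^m$ such that $\mathcal{B}_E\subseteq V_E$ and $\dim V_E\leq d-2$.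
   Context: $\mathcal{H}^1$ is $1$-dimensional Hausdorff measure. A Borel set $E\subseteq\mathbb{R}^d$ is $1$-rectifiable if there are Lipschitz maps $f_j:\mathbb{R}\to\mathbb{R}^d$, $j\in\mathbb{N}$, with $\mathcal{H}^1(E\setminus\bigcup_j f_j(\mathbb{R}))=0$. For $\boldsymbol{\alpha}=(\alpha_1,\ldots,\alpha_d)\in\mathcal{A}^d$ let $\mathsf{H}_{\boldsymbol{\alpha}}=(\varphi_{\alpha_1},\ldots,\varphi_{\alpha_d}):\mathbb{R}^d\to\mathbb{R}^d$ and $\Sigma_{\boldsymbol{\alpha}}=\{x\in\mathbb{R}^d:\operatorname{rank}D_x\mathsf{H}_{\boldsymbol{\alpha}}(x)\leq d-1\}$. The tuple $\boldsymbol{\alpha}$ is admissible if there is a $C^1$ embedded $(d-1)$-dimensional submanifold $M\subset\mathbb{R}^d$ (possibly empty) with $\Sigma_{\boldsymbol{\alpha}}\subseteq M$ (critical-hypersurface condition) and $\operatorname{rank}(D_x\mathsf{H}_{\boldsymbol{\alpha}}(x)|_{T_xM})=d-1$ for every $x\in M$ (tangential-immersion condition). *)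

theory Defs
  imports "HOL-Analysis.Analysis"
begin

section \<open>One-dimensional Hausdorff measure and rectifiability\<close>

text \<open>Covers by countably many sets of diameter at most \<open>\<delta>\<close>.  Boundedness is required explicitly
  because \<^const>\<open>diameter\<close> is a real number and carries no information on unbounded sets.  If no
  such cover exists the infimum is \<open>\<infinity>\<close>.\<close>

definition hausdorff1_premeasure :: "real \<Rightarrow> 'a::metric_space set \<Rightarrow> ennreal" where
  "hausdorff1_premeasure \<delta> S =
     (INF C \<in> {C :: nat \<Rightarrow> 'a set. S \<subseteq> (\<Union>i. C i) \<and> (\<forall>i. bounded (C i) \<and> diameter (C i) \<le> \<delta>)}.
        (\<Sum>i. ennreal (diameter (C i))))"

text \<open>This is the outer measure, defined on all sets: the image of a Borel set under a continuous
  function need not be Borel.  In dimension one the usual normalising constant is \<open>1\<close>.\<close>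

definition hausdorff1 :: "'a::metric_space set \<Rightarrow> ennreal" where
  "hausdorff1 S = (SUP \<delta> \<in> {0<..}. hausdorff1_premeasure \<delta> S)"

definition rectifiable1 :: "'a::metric_space set \<Rightarrow> bool" where
  "rectifiable1 E \<longleftrightarrow>
     (\<exists>f :: nat \<Rightarrow> real \<Rightarrow> 'a. (\<forall>j. \<exists>L. L-lipschitz_on UNIV (f j)) \<and>
        hausdorff1 (E - (\<Union>j. range (f j))) = 0)"

section \<open>Continuously differentiable maps and embedded submanifolds\<close>

text \<open>Used only for open \<open>U\<close>.  Continuity of the derivative is with respect to the
  operator norm.\<close>

definition C1_on :: "'a::real_normed_vector set \<Rightarrow> ('a \<Rightarrow> 'b::real_normed_vector) \<Rightarrow> bool" where
  "C1_on U f \<longleftrightarrow>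
     (\<exists>f' :: 'a \<Rightarrow> 'a \<Rightarrow>\<^sub>L 'b. (\<forall>x\<in>U. (f has_derivative blinfun_apply (f' x)) (at x)) \<and>
        continuous_on U f')"

definition C2_on :: "'a::real_normed_vector set \<Rightarrow> ('a \<Rightarrow> 'b::real_normed_vector) \<Rightarrow> bool" where
  "C2_on U f \<longleftrightarrow>
     (\<exists>f' :: 'a \<Rightarrow> 'a \<Rightarrow>\<^sub>L 'b. (\<forall>x\<in>U. (f has_derivative blinfun_apply (f' x)) (at x)) \<and>
        C1_on U f')"

text \<open>Around each of its points, \<open>M\<close> is carried onto a piece of a \<open>k\<close>-dimensional linear subspace
  by a \<open>C\<^sup>1\<close> diffeomorphism between open subsets of the ambient space.  The empty set qualifies for
  every \<open>k\<close>.\<close>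

definition C1_submanifold :: "nat \<Rightarrow> 'a::euclidean_space set \<Rightarrow> bool" where
  "C1_submanifold k M \<longleftrightarrow>
     (\<forall>x\<in>M. \<exists>U V S (\<Phi> :: 'a \<Rightarrow> 'a) (\<Psi> :: 'a \<Rightarrow> 'a).
        open U \<and> open V \<and> x \<in> U \<and>
        homeomorphism U V \<Phi> \<Psi> \<and> C1_on U \<Phi> \<and> C1_on V \<Psi> \<and>
        subspace S \<and> dim S = k \<and> \<Phi> ` (U \<inter> M) = V \<inter> S)"

text \<open>Velocities at \<open>x\<close> of \<open>C\<^sup>1\<close> curves in \<open>M\<close>.\<close>

definition tangent_space :: "'a::euclidean_space set \<Rightarrow> 'a \<Rightarrow> 'a set" where
  "tangent_space M x =
     {v. \<exists>\<gamma> \<epsilon>. \<epsilon> > 0 \<and> \<gamma> C1_differentiable_on {-\<epsilon><..<\<epsilon>} \<and> \<gamma> ` {-\<epsilon><..<\<epsilon>} \<subseteq> M \<and>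
           \<gamma> 0 = x \<and> (\<gamma> has_vector_derivative v) (at 0)}"

section \<open>Admissible tuples\<close>

text \<open>A \<open>d\<close>-tuple of parameters is a function on the coordinate type \<open>'d\<close> of the ambient space
  \<open>real^'d\<close>.\<close>

definition tuple_map :: "('a \<Rightarrow> real^'d \<Rightarrow> real) \<Rightarrow> ('d \<Rightarrow> 'a) \<Rightarrow> real^'d \<Rightarrow> real^'d" where
  "tuple_map \<phi> \<alpha> x = (\<chi> i. \<phi> (\<alpha> i) x)"

text \<open>The rank of a linear map on a subspace is the dimension of the image of that subspace.\<close>

definition critical_set :: "('a \<Rightarrow> real^'d \<Rightarrow> real) \<Rightarrow> ('d \<Rightarrow> 'a) \<Rightarrow> (real^'d) set" where
  "critical_set \<phi> \<alpha> =
     {x. dim (range (frechet_derivative (tuple_map \<phi> \<alpha>) (at x))) \<le> CARD('d) - 1}"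

definition admissible :: "('a \<Rightarrow> real^'d \<Rightarrow> real) \<Rightarrow> ('d \<Rightarrow> 'a) \<Rightarrow> bool" where
  "admissible \<phi> \<alpha> \<longleftrightarrow>
     (\<exists>M. C1_submanifold (CARD('d) - 1) M \<and>
        critical_set \<phi> \<alpha> \<subseteq> M \<and>
        (\<forall>x\<in>M. dim (frechet_derivative (tuple_map \<phi> \<alpha>) (at x) ` tangent_space M x)
                  = CARD('d) - 1))"

definition admissible_tuples ::
  "'a set \<Rightarrow> ('a \<Rightarrow> real^'d \<Rightarrow> real) \<Rightarrow> ('d \<Rightarrow> 'a) set" where
  "admissible_tuples A \<phi> = {\<alpha> \<in> UNIV \<rightarrow> A. admissible \<phi> \<alpha>}"

definition bad_params ::
  "'a set \<Rightarrow> ('a \<Rightarrow> real^'d \<Rightarrow> real) \<Rightarrow> (real^'d) set \<Rightarrow> 'a set" where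
  "bad_params A \<phi> E = {\<alpha> \<in> A. hausdorff1 (\<phi> \<alpha> ` E) = 0}"

text \<open>Affine independence of the tuple, not just of the set of its entries: repetitions are
  excluded.\<close>

definition affinely_independent_tuple :: "('i \<Rightarrow> 'b::real_vector) \<Rightarrow> bool" where
  "affinely_independent_tuple \<alpha> \<longleftrightarrow> inj \<alpha> \<and> \<not> affine_dependent (range \<alpha>)"

end

theory Submission
  imports Defs
begin

text \<open>Let \<open>H\<close> be the map of an admissible tuple with hypersurface \<open>M\<close>.  Off \<open>M\<close> the derivative of \<open>H\<close>
  is injective, and on \<open>M\<close> it is injective on tangent vectors, so locally \<open>H\<close> expands distances, up to a
  constant, both on \<open>E - M\<close> and on \<open>E \<inter> M\<close>.  Hence it is enough that \<open>\<H>\<^sup>1\<close> vanishes on the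
  \<open>H\<close>-image of such a piece of \<open>E\<close>.  This image lies, up to a null set, on countably many Lipschitz
  curves, and its coordinate projections are null.  A piece of a Lipschitz curve with null coordinate
  projections is \<open>\<H>\<^sup>1\<close>-null: the variation of a coordinate function \<open>h\<close> over \<open>h\<^sup>-\<^sup>1(O)\<close> is at most
  the integral over \<open>O\<close> of the (integrable) Banach indicatrix of \<open>h\<close>, which is small for a suitable open
  neighbourhood \<open>O\<close> of a null set.\<close>

section \<open>Null sets of one-dimensional Hausdorff measure\<close>

text \<open>A supremum of nonnegative quantities vanishes iff each of them does, and an infimum
  vanishes iff it is approached within every positive error. The covering arguments below all start
  from this form.\<close>

lemma hausdorff1_eq_0_iff:
  "hausdorff1 S = 0 \<longleftrightarrow>
    (\<forall>\<delta>>0. \<forall>\<epsilon>>0. \<exists>C. S \<subseteq> (\<Union>i::nat. C i) \<and> (\<forall>i. bounded (C i) \<and> diameter (C i) \<le> \<delta>) \<and>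
       (\<Sum>i. ennreal (diameter (C i))) \<le> ennreal \<epsilon>)"
  (is "_ \<longleftrightarrow> ?R")
proof
  assume S: "hausdorff1 S = 0"
  show ?R
  proof (intro allI impI)
    fix \<delta> \<epsilon> :: real assume "\<delta> > 0" "\<epsilon> > 0"
    have "hausdorff1_premeasure \<delta> S \<le> hausdorff1 S"
      unfolding hausdorff1_def using \<open>\<delta> > 0\<close> by (intro SUP_upper) auto
    then have "hausdorff1_premeasure \<delta> S < ennreal \<epsilon>"
      using S \<open>\<epsilon> > 0\<close> by simp
    then show "\<exists>C. S \<subseteq> (\<Union>i::nat. C i) \<and> (\<forall>i. bounded (C i) \<and> diameter (C i) \<le> \<delta>) \<and>
       (\<Sum>i. ennreal (diameter (C i))) \<le> ennreal \<epsilon>"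
      unfolding hausdorff1_premeasure_def INF_less_iff by (auto intro: less_imp_le)
  qed
next
  assume R: ?R
  have "hausdorff1_premeasure \<delta> S \<le> 0" if "\<delta> > 0" for \<delta>
  proof (rule ennreal_le_epsilon)
    fix e :: real assume "e > 0"
    obtain C where C: "S \<subseteq> (\<Union>i::nat. C i)" "\<forall>i. bounded (C i) \<and> diameter (C i) \<le> \<delta>"
        "(\<Sum>i. ennreal (diameter (C i))) \<le> ennreal e"
      using R \<open>\<delta> > 0\<close> \<open>e > 0\<close> by blast
    have "hausdorff1_premeasure \<delta> S \<le> (\<Sum>i. ennreal (diameter (C i)))"
      unfolding hausdorff1_premeasure_def using C by (intro INF_lower) auto
    with C show "hausdorff1_premeasure \<delta> S \<le> 0 + ennreal e" by simp
  qed
  then show "hausdorff1 S = 0"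
    unfolding hausdorff1_def by (simp add: SUP_eq_const bot_ennreal[symmetric] le_bot)
qed

text \<open>The error \<epsilon> is shared out as \<epsilon>/2^(n+1), and the double family of
  covering sets is enumerated by \<open>prod_decode\<close>. Allowing \<open>X\<close> to be any
  subset of the union makes monotonicity a special case.\<close>

lemma hausdorff1_null_UN:
  fixes S :: "nat \<Rightarrow> 'a::metric_space set"
  assumes "\<And>n. hausdorff1 (S n) = 0" and "X \<subseteq> (\<Union>n. S n)"
  shows "hausdorff1 X = 0"
  unfolding hausdorff1_eq_0_iff
proof (intro allI impI)
  fix \<delta> \<epsilon> :: real assume "\<delta> > 0" "\<epsilon> > 0"
  have "\<exists>C. S n \<subseteq> (\<Union>i::nat. C i) \<and> (\<forall>i. bounded (C i) \<and> diameter (C i) \<le> \<delta>) \<and>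
       (\<Sum>i. ennreal (diameter (C i))) \<le> ennreal (\<epsilon> * (1/2)^Suc n)" for n
    using assms(1)[of n, unfolded hausdorff1_eq_0_iff, rule_format, of \<delta> "\<epsilon> * (1/2)^Suc n"] \<open>\<epsilon> > 0\<close> \<open>\<delta> > 0\<close>
    by simp
  then obtain C where C: "\<And>n. S n \<subseteq> (\<Union>i::nat. C n i)"
      "\<And>n i. bounded (C n i)" "\<And>n i. diameter (C n i) \<le> \<delta>"
      "\<And>n. (\<Sum>i. ennreal (diameter (C n i))) \<le> ennreal (\<epsilon> * (1/2)^Suc n)"
    by metis
  define D where "D i = case_prod C (prod_decode i)" for i
  have "X \<subseteq> (\<Union>i. D i)"
  proof
    fix x assume "x \<in> X"
    then obtain n i where "x \<in> C n i" using assms(2) C(1) by blast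
    then have "x \<in> D (prod_encode (n, i))" by (simp add: D_def)
    then show "x \<in> (\<Union>i. D i)" by blast
  qed
  moreover have "\<forall>i. bounded (D i) \<and> diameter (D i) \<le> \<delta>"
    using C by (auto simp: D_def split: prod.splits)
  moreover have "(\<Sum>i. ennreal (diameter (D i))) \<le> ennreal \<epsilon>"
  proof -
    have "(\<Sum>i. ennreal (diameter (D i))) = (\<Sum>n. \<Sum>i. ennreal (diameter (C n i)))"
      unfolding D_def
      using suminf_ennreal_2dimen[of "\<lambda>m. \<Sum>i. ennreal (diameter (C m i))" "\<lambda>p. ennreal (diameter (case_prod C p))"]
      by (simp add: comp_def)
    also have "\<dots> \<le> (\<Sum>n. ennreal (\<epsilon> * (1/2)^Suc n))"
      by (intro suminf_le C(4)) auto
    also have "\<dots> = ennreal \<epsilon>"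
      using \<open>\<epsilon> > 0\<close> sums_mult[OF power_half_series, of \<epsilon>]
      by (intro suminf_ennreal_eq) auto
    finally show ?thesis .
  qed
  ultimately show "\<exists>C. X \<subseteq> (\<Union>i::nat. C i) \<and> (\<forall>i. bounded (C i) \<and> diameter (C i) \<le> \<delta>) \<and>
       (\<Sum>i. ennreal (diameter (C i))) \<le> ennreal \<epsilon>"
    by blast
qed

lemma hausdorff1_null_subset: "hausdorff1 T = 0 \<Longrightarrow> S \<subseteq> T \<Longrightarrow> hausdorff1 S = 0"
  using hausdorff1_null_UN[of "\<lambda>_. T" S] by auto

text \<open>On the image of \<open>X\<close> the inverse of \<open>f\<close> is Lipschitz with
  constant \<open>1/c\<close>, so pulling a cover back to \<open>X\<close> enlarges diameters by at
  most that factor.\<close>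

lemma hausdorff1_null_expanding:
  fixes f :: "'a::metric_space \<Rightarrow> 'b::metric_space"
  assumes "c > 0" and exp: "\<And>x y. x \<in> X \<Longrightarrow> y \<in> X \<Longrightarrow> c * dist x y \<le> dist (f x) (f y)"
    and null: "hausdorff1 (f ` X) = 0"
  shows "hausdorff1 X = 0"
  unfolding hausdorff1_eq_0_iff
proof (intro allI impI)
  fix \<delta> \<epsilon> :: real assume "\<delta> > 0" "\<epsilon> > 0"
  obtain C where C: "f ` X \<subseteq> (\<Union>i::nat. C i)" "\<And>i. bounded (C i)" "\<And>i. diameter (C i) \<le> c * \<delta>"
      "(\<Sum>i. ennreal (diameter (C i))) \<le> ennreal (c * \<epsilon>)"
    using null[unfolded hausdorff1_eq_0_iff, rule_format, of "c * \<delta>" "c * \<epsilon>"]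
      \<open>\<epsilon> > 0\<close> \<open>\<delta> > 0\<close> \<open>c > 0\<close> by auto
  define D where "D i = X \<inter> f -` C i" for i
  have D: "dist x y \<le> diameter (C i) / c" if "x \<in> D i" "y \<in> D i" for x y i
  proof -
    have "c * dist x y \<le> dist (f x) (f y)" using that by (intro exp) (auto simp: D_def)
    also have "\<dots> \<le> diameter (C i)"
      using that by (intro diameter_bounded_bound C) (auto simp: D_def)
    finally show ?thesis using \<open>c > 0\<close> by (simp add: field_simps)
  qed
  have bd: "bounded (D i)" for i
  proof (cases "D i = {}")
    case False
    then obtain x where "x \<in> D i" by blast
    then show ?thesis
      unfolding bounded_def using D[of x i] by blast
  qed simp
  have dD: "diameter (D i) \<le> diameter (C i) / c" for i
  proof (cases "D i = {}")
    case True then show ?thesis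
      using C(2)[of i] \<open>c > 0\<close> by (simp add: diameter_ge_0)
  next
    case False then show ?thesis
      using D[of _ i] unfolding diameter_def[of "D i"] by (auto intro!: cSUP_least)
  qed
  have "X \<subseteq> (\<Union>i. D i)" using C(1) by (fastforce simp: D_def)
  moreover have "diameter (D i) \<le> \<delta>" for i
  proof -
    have "diameter (C i) / c \<le> \<delta>"
      using C(3)[of i] \<open>c > 0\<close> by (simp add: field_simps)
    then show ?thesis using dD[of i] by linarith
  qed
  moreover have "(\<Sum>i. ennreal (diameter (D i))) \<le> ennreal \<epsilon>"
  proof -
    have "(\<Sum>i. ennreal (diameter (D i))) \<le> (\<Sum>i. ennreal (1/c) * ennreal (diameter (C i)))"
      using dD \<open>c > 0\<close> by (intro suminf_le) (auto simp flip: ennreal_mult' intro!: ennreal_leI)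
    also have "\<dots> = ennreal (1/c) * (\<Sum>i. ennreal (diameter (C i)))"
      by simp
    also have "\<dots> \<le> ennreal (1/c) * ennreal (c * \<epsilon>)"
      by (intro mult_left_mono C) auto
    also have "\<dots> = ennreal \<epsilon>"
      using \<open>c > 0\<close> \<open>\<epsilon> > 0\<close> by (simp flip: ennreal_mult)
    finally show ?thesis .
  qed
  ultimately show "\<exists>C. X \<subseteq> (\<Union>i::nat. C i) \<and> (\<forall>i. bounded (C i) \<and> diameter (C i) \<le> \<delta>) \<and>
       (\<Sum>i. ennreal (diameter (C i))) \<le> ennreal \<epsilon>"
    using bd by blast
qed

text \<open>A set on the line lies in the closed ball around any of its points with radius its
  diameter, so a cover by sets becomes a cover by intervals of at most twice the total size.\<close>

lemma negligible_if_hausdorff1_null: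
  fixes S :: "real set"
  assumes "hausdorff1 S = 0"
  shows "negligible S"
  unfolding negligible_outer
proof (intro allI impI)
  fix e :: real assume "e > 0"
  \<comment> \<open>The doubling turns \<open>e/4\<close> into \<open>e/2\<close>, which leaves room
    for the strict inequality.\<close>
  obtain C where C: "S \<subseteq> (\<Union>i::nat. C i)" "\<And>i. bounded (C i)"
      "(\<Sum>i. ennreal (diameter (C i))) \<le> ennreal (e/4)"
    using assms[unfolded hausdorff1_eq_0_iff, rule_format, of 1 "e/4"] \<open>e > 0\<close> by auto
  have "\<exists>x. C i \<subseteq> cball x (diameter (C i))" for i
  proof (cases "C i = {}")
    case False
    then obtain x where "x \<in> C i" by blast
    then have "C i \<subseteq> cball x (diameter (C i))"
      using diameter_bounded_bound[OF C(2)] by auto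
    then show ?thesis ..
  qed simp
  then obtain x where x: "\<And>i. C i \<subseteq> cball (x i) (diameter (C i))" by metis
  define T where "T = (\<Union>i. cball (x i) (diameter (C i)))"
  have "emeasure lborel T \<le> (\<Sum>i. emeasure lborel (cball (x i) (diameter (C i))))"
    unfolding T_def by (intro emeasure_subadditive_countably) auto
  also have "\<dots> = (\<Sum>i. 2 * ennreal (diameter (C i)))"
  proof (intro suminf_cong)
    fix i
    have "diameter (C i) \<ge> 0" using C(2) by (rule diameter_ge_0)
    then have "emeasure lborel (cball (x i) (diameter (C i))) = ennreal (2 * diameter (C i))"
      by (simp add: cball_eq_atLeastAtMost)
    then show "emeasure lborel (cball (x i) (diameter (C i))) = 2 * ennreal (diameter (C i))"
      by (simp add: ennreal_mult')
  qed
  also have "\<dots> \<le> 2 * ennreal (e/4)"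
    using C(3) by (simp add: mult_left_mono)
  also have "\<dots> = ennreal (e/2)"
    using ennreal_mult'[of 2 "e/4"] by simp
  finally have T: "emeasure lborel T \<le> ennreal (e/2)" .
  have [measurable]: "T \<in> sets borel" unfolding T_def by auto
  have lT: "emeasure lebesgue T = emeasure lborel T" by simp
  have "T \<in> lmeasurable"
    using T lT by (intro fmeasurableI) (auto simp: less_top[symmetric] top_unique)
  moreover have "measure lebesgue T < e"
    using enn2real_leI[of "e/2" "emeasure lborel T"] T lT \<open>e > 0\<close>
    by (simp add: measure_def)
  moreover have "S \<subseteq> T" using C(1) x unfolding T_def by blast
  ultimately show "\<exists>T. S \<subseteq> T \<and> T \<in> lmeasurable \<and> measure lebesgue T < e" by blast
qed

section \<open>Null sets: arbitrary countable index sets and localisation\<close>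

lemma hausdorff1_null_countable_UN:
  fixes S :: "'i \<Rightarrow> 'a::metric_space set"
  assumes "countable I" "\<And>i. i \<in> I \<Longrightarrow> hausdorff1 (S i) = 0" "X \<subseteq> (\<Union>i\<in>I. S i)"
  shows "hausdorff1 X = 0"
proof (cases "I = {}")
  case True
  have "hausdorff1 ({} :: 'a set) = 0"
    unfolding hausdorff1_eq_0_iff by (intro allI impI exI[of _ "\<lambda>_. {}"]) simp
  then show ?thesis using True assms(3) by simp
next
  case False
  show ?thesis
  proof (rule hausdorff1_null_UN)
    show "hausdorff1 (S (from_nat_into I n)) = 0" for n
      by (rule assms(2)[OF from_nat_into[OF False]])
    show "X \<subseteq> (\<Union>n. S (from_nat_into I n))"
    proof
      fix x assume "x \<in> X"
      then obtain i where "i \<in> I" "x \<in> S i" using assms(3) by blast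
      moreover then obtain n where "from_nat_into I n = i"
        using from_nat_into_surj[OF assms(1)] by blast
      ultimately show "x \<in> (\<Union>n. S (from_nat_into I n))" by blast
    qed
  qed
qed

text \<open>By Lindelof, countably many open sets that meet \<open>X\<close> in a null set already
  cover \<open>X\<close>. This is what makes local expansion estimates sufficient.\<close>

lemma hausdorff1_null_local:
  fixes X :: "'a::{metric_space, second_countable_topology} set"
  assumes "\<And>x. x \<in> X \<Longrightarrow> \<exists>r>0. hausdorff1 (X \<inter> ball x r) = 0"
  shows "hausdorff1 X = 0"
proof -
  define \<F> where "\<F> = {U. open U \<and> hausdorff1 (X \<inter> U) = 0}"
  obtain \<G> where \<G>: "\<G> \<subseteq> \<F>" "countable \<G>" "\<Union>\<G> = \<Union>\<F>"
    by (rule Lindelof[of \<F>]) (auto simp: \<F>_def)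
  have "X \<subseteq> \<Union>\<F>"
  proof
    fix x assume "x \<in> X"
    then obtain r where "r > 0" "hausdorff1 (X \<inter> ball x r) = 0" using assms by blast
    then have "ball x r \<in> \<F>" "x \<in> ball x r" by (simp_all add: \<F>_def)
    then show "x \<in> \<Union>\<F>" by blast
  qed
  then have "X \<subseteq> (\<Union>U\<in>\<G>. X \<inter> U)" using \<G>(3) by blast
  then show ?thesis
    by (rule hausdorff1_null_countable_UN[OF \<G>(2), rotated]) (use \<G>(1) in \<open>auto simp: \<F>_def\<close>)
qed

section \<open>Curves with null coordinate projections\<close>

text \<open>\<open>N\<close> plays the role of the Banach indicatrix, the number of preimages of a point.\<close>

lemma indicatrix_majorant:
  fixes h :: "real \<Rightarrow> real"
  assumes L: "L-lipschitz_on {0..1} h"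
  obtains N :: "real \<Rightarrow> ennreal" where "N \<in> borel_measurable borel" "(\<integral>\<^sup>+y. N y \<partial>lborel) < \<infinity>"
    "\<And>F y. finite F \<Longrightarrow> disjoint F \<Longrightarrow> \<Union>F \<subseteq> {0..<1} \<Longrightarrow> (\<Sum>J\<in>F. indicator (h ` J) y) \<le> N y"
proof -
  have L0: "L \<ge> 0" using L by (rule lipschitz_on_nonneg)
  have cont: "continuous_on {0..1} h" using L by (rule lipschitz_on_continuous_on)
  \<comment> \<open>These half-open intervals, for \<open>j < Suc n\<close>, partition [0,1) with
    mesh \<open>1 / Suc n\<close>.\<close>
  define I where "I n j = {real j / real (Suc n) ..< (real j + 1) / real (Suc n)}" for n j
  have I01: "I n j \<subseteq> {0..1}" if "j < Suc n" for n j
  proof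
    fix t assume "t \<in> I n j"
    moreover have "(real j + 1) / real (Suc n) \<le> 1" "real j / real (Suc n) \<ge> 0"
      using that by auto
    ultimately show "t \<in> {0..1}" unfolding I_def atLeastLessThan_iff atLeastAtMost_iff by linarith
  qed
  have meas: "h ` I n j \<in> sets borel" if "j < Suc n" for n j
  proof -
    have "connected (h ` I n j)"
      using continuous_on_subset[OF cont I01[OF that]]
      by (intro connected_continuous_image) (auto simp: I_def)
    then show ?thesis
      by (simp add: is_interval_connected_1[symmetric] real_interval_borel_measurable)
  qed
  have em: "emeasure lborel (h ` I n j) \<le> ennreal (2 * L / Suc n)" if "j < Suc n" for n j
  proof -
    let ?a = "real j / Suc n"
    have "?a \<in> I n j" by (auto simp: I_def divide_simps)
    have "h ` I n j \<subseteq> {h ?a - L / Suc n .. h ?a + L / Suc n}"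
    proof
      fix y assume "y \<in> h ` I n j"
      then obtain t where t: "t \<in> I n j" "y = h t" by blast
      have "dist (h t) (h ?a) \<le> L * dist t ?a"
        using t I01[OF that] \<open>?a \<in> I n j\<close> by (intro lipschitz_onD[OF L]) auto
      also have "\<dots> \<le> L * (1 / Suc n)"
        using t L0 by (intro mult_left_mono) (auto simp: I_def dist_real_def add_divide_distrib)
      finally show "y \<in> {h ?a - L / Suc n .. h ?a + L / Suc n}"
        using t by (auto simp: dist_real_def)
    qed
    then have "emeasure lborel (h ` I n j) \<le> emeasure lborel {h ?a - L / Suc n .. h ?a + L / Suc n}"
      by (intro emeasure_mono) auto
    also have "\<dots> = ennreal (2 * L / Suc n)"
      using L0 by simp
    finally show ?thesis .
  qed
  \<comment> \<open>This counts the partition intervals whose image hits \<open>y\<close>. Each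
    image has length at most \<open>2 * L / Suc n\<close>, so the integral stays below
    \<open>2 * L\<close> for every \<open>n\<close>.\<close>
  define N' :: "nat \<Rightarrow> real \<Rightarrow> ennreal" where "N' n y = (\<Sum>j<Suc n. indicator (h ` I n j) y)" for n y
  have N'meas: "N' n \<in> borel_measurable borel" for n
    unfolding N'_def using meas by (intro borel_measurable_sum borel_measurable_indicator) auto
  have N'int: "(\<integral>\<^sup>+y. N' n y \<partial>lborel) \<le> ennreal (2 * L)" for n
  proof -
    have "(\<integral>\<^sup>+y. N' n y \<partial>lborel) = (\<Sum>j<Suc n. (\<integral>\<^sup>+y. indicator (h ` I n j) y \<partial>lborel))"
      unfolding N'_def using meas by (intro nn_integral_sum) auto
    also have "\<dots> = (\<Sum>j<Suc n. emeasure lborel (h ` I n j))"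
      using meas by (intro sum.cong) auto
    also have "\<dots> \<le> (\<Sum>j<Suc n. ennreal (2 * L / Suc n))"
      by (intro sum_mono em) auto
    also have "\<dots> = ennreal (2 * L)"
      using L0 by (subst sum_ennreal) (auto simp del: sum.lessThan_Suc of_nat_Suc)
    finally show ?thesis .
  qed
  \<comment> \<open>Successive partitions are in general not nested, so \<open>N'\<close> need not
    be monotone in \<open>n\<close>. The liminf still works: Fatou bounds its integral, and an
    eventual lower bound on \<open>N' n y\<close> passes to it.\<close>
  define N where "N y = liminf (\<lambda>n. N' n y)" for y
  show ?thesis
  proof
    show "N \<in> borel_measurable borel"
      unfolding N_def using N'meas by (intro borel_measurable_liminf)
    have "(\<integral>\<^sup>+y. N y \<partial>lborel) \<le> liminf (\<lambda>n. \<integral>\<^sup>+y. N' n y \<partial>lborel)"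
      unfolding N_def using N'meas by (intro nn_integral_liminf) auto
    also have "\<dots> \<le> ennreal (2 * L)"
      using N'int by (intro Liminf_le) auto
    finally show "(\<integral>\<^sup>+y. N y \<partial>lborel) < \<infinity>"
      by (simp add: le_less_trans)
  next
    fix F :: "real set set" and y :: real
    assume F: "finite F" "disjoint F" "\<Union>F \<subseteq> {0..<1}"
    \<comment> \<open>Only members of \<open>F\<close> whose image contains \<open>y\<close>
      contribute. A preimage \<open>t J\<close> chosen in each of them gives distinct points, as the
      members are disjoint.\<close>
    define G where "G = {J \<in> F. y \<in> h ` J}"
    have "finite G" using F by (simp add: G_def)
    have "\<forall>J\<in>G. \<exists>t\<in>J. h t = y" by (auto simp: G_def)
    then obtain t where t: "\<And>J. J \<in> G \<Longrightarrow> t J \<in> J" "\<And>J. J \<in> G \<Longrightarrow> h (t J) = y" by metis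
    have t01: "t J \<in> {0..<1}" if "J \<in> G" for J using t(1)[OF that] that F(3) by (auto simp: G_def)
    have inj: "inj_on t G"
    proof (rule inj_onI, rule ccontr)
      fix J K assume JK: "J \<in> G" "K \<in> G" "t J = t K" "J \<noteq> K"
      then have "J \<inter> K = {}" using F(2) by (auto simp: G_def disjoint_def)
      then show False using JK t(1)[of J] t(1)[of K] by auto
    qed
    \<comment> \<open>Once the mesh is smaller than every gap between the chosen points, no two of
      them share a partition interval, so \<open>N' n y\<close> counts at least
      \<open>card G\<close> intervals.\<close>
    have ev: "\<forall>\<^sub>F n in sequentially. (\<Sum>J\<in>F. indicator (h ` J) y) \<le> N' n y"
    proof -
      have "\<forall>\<^sub>F n in sequentially. J \<noteq> K \<longrightarrow> 1 / real (Suc n) < \<bar>t J - t K\<bar>"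
        if "J \<in> G" "K \<in> G" for J K
      proof (cases "J = K")
        case False
        then have "\<bar>t J - t K\<bar> > 0" using inj_onD[OF inj _ that] by auto
        then show ?thesis
          using order_tendstoD(2)[OF LIMSEQ_inverse_real_of_nat, of "\<bar>t J - t K\<bar>"]
          by (simp add: inverse_eq_divide)
      qed simp
      then have "\<forall>\<^sub>F n in sequentially. \<forall>J\<in>G. \<forall>K\<in>G. J \<noteq> K \<longrightarrow> 1 / real (Suc n) < \<bar>t J - t K\<bar>"
        using \<open>finite G\<close> by (intro eventually_ball_finite ballI)
      then show ?thesis
      proof eventually_elim
        case (elim n)
        define k where "k J = nat \<lfloor>real (Suc n) * t J\<rfloor>" for J
        have k: "real (k J) \<le> real (Suc n) * t J" "real (Suc n) * t J < real (k J) + 1" if "J \<in> G" for J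
        proof -
          have "real (Suc n) * t J \<ge> 0" using t01[OF that] by simp
          then show "real (k J) \<le> real (Suc n) * t J" "real (Suc n) * t J < real (k J) + 1"
            unfolding k_def by linarith+
        qed
        have kI: "t J \<in> I n (k J)" if "J \<in> G" for J
          using k[OF that] by (simp add: I_def field_simps del: of_nat_Suc)
        have kn: "k J < Suc n" if "J \<in> G" for J
        proof -
          have "real (Suc n) * t J < real (Suc n) * 1"
            using t01[OF that] by (intro mult_strict_left_mono) auto
          then have "real (k J) < real (Suc n)"
            using le_less_trans[OF k(1)[OF that]] unfolding mult_1_right by blast
          then show ?thesis by simp
        qed
        have "inj_on k G"
        proof (rule inj_onI, rule ccontr)
          fix J K assume JK: "J \<in> G" "K \<in> G" "k J = k K" "J \<noteq> K"
          then have "1 / Suc n < \<bar>t J - t K\<bar>" using elim by blast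
          moreover have "\<bar>t J - t K\<bar> < 1 / Suc n"
            using kI[OF JK(1)] kI[OF JK(2)] JK(3) by (auto simp: I_def add_divide_distrib abs_less_iff)
          ultimately show False by simp
        qed
        have "(\<Sum>J\<in>F. indicator (h ` J) y) = (\<Sum>J\<in>G. 1 :: ennreal)"
          using F(1) by (intro sum.mono_neutral_cong_right) (auto simp: G_def)
        also have "\<dots> = (\<Sum>j\<in>k ` G. 1)" by (simp add: card_image[OF \<open>inj_on k G\<close>])
        also have "\<dots> \<le> (\<Sum>j\<in>k ` G. indicator (h ` I n j) y)"
          using kI t(2) by (intro sum_mono) (force simp: indicator_def)
        also have "\<dots> \<le> N' n y"
          unfolding N'_def using kn by (intro sum_mono2) auto
        finally show ?case .
      qed
    qed
    then show "(\<Sum>J\<in>F. indicator (h ` J) y) \<le> N y"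
      unfolding N_def by (intro Liminf_bounded)
  qed
qed

text \<open>Lebesgue measure weighted by the indicatrix majorant is finite and does not charge null
  sets, so by outer regularity the null image has an open neighbourhood of small mass. The total
  length of the images of disjoint pieces is the integral of their multiplicity; if the images stay
  in that neighbourhood, this is at most its mass.\<close>

lemma small_oscillation_cover:
  fixes h :: "real \<Rightarrow> real"
  assumes L: "L-lipschitz_on {0..1} h" and null: "negligible (h ` A)" and "\<epsilon> > 0"
  shows "\<exists>U. open U \<and> h ` A \<subseteq> U \<and>
    (\<forall>F. finite F \<and> disjoint F \<and> \<Union>F \<subseteq> {0..<1} \<and> h ` \<Union>F \<subseteq> U \<and> (\<forall>J\<in>F. h ` J \<in> sets borel) \<longrightarrow>
       (\<Sum>J\<in>F. emeasure lborel (h ` J)) \<le> ennreal \<epsilon>)"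
proof -
  obtain N :: "real \<Rightarrow> ennreal" where N: "N \<in> borel_measurable borel" "(\<integral>\<^sup>+y. N y \<partial>lborel) < \<infinity>"
    "\<And>F y. finite F \<Longrightarrow> disjoint F \<Longrightarrow> \<Union>F \<subseteq> {0..<1} \<Longrightarrow> (\<Sum>J\<in>F. indicator (h ` J) y) \<le> N y"
    using indicatrix_majorant[OF L] by blast
  define \<nu> where "\<nu> = density lborel N"
  have [measurable]: "N \<in> borel_measurable borel" by (rule N)
  have sets: "sets \<nu> = sets borel" by (simp add: \<nu>_def)
  have fin: "emeasure \<nu> (space \<nu>) \<noteq> \<infinity>"
    using N(2) by (simp add: \<nu>_def emeasure_density)
  \<comment> \<open>The image of \<open>A\<close> need not be Borel, so a Borel null superset takes
    its place before outer regularity is applied.\<close>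
  obtain Z where Z: "Z \<in> null_sets lborel" "h ` A \<subseteq> Z"
    using null unfolding negligible_iff_null_sets null_sets_completion_iff2 by blast
  have "Z \<in> sets borel" using Z by auto
  have "AE y in lborel. y \<notin> Z" using Z(1) by (rule AE_not_in)
  then have "emeasure \<nu> Z = 0"
    using \<open>Z \<in> sets borel\<close> unfolding \<nu>_def
    by (subst emeasure_density) (auto simp: nn_integral_0_iff_AE)
  then have "(INF U \<in> {U. Z \<subseteq> U \<and> open U}. emeasure \<nu> U) < ennreal \<epsilon>"
    using outer_regular[OF sets fin \<open>Z \<in> sets borel\<close>] \<open>\<epsilon> > 0\<close> by simp
  then obtain U where U: "Z \<subseteq> U" "open U" "emeasure \<nu> U < ennreal \<epsilon>"
    unfolding INF_less_iff by blast
  show ?thesis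
  proof (intro exI[of _ U] conjI allI impI)
    show "open U" "h ` A \<subseteq> U" using U Z by auto
    fix F :: "real set set"
    assume "finite F \<and> disjoint F \<and> \<Union>F \<subseteq> {0..<1} \<and> h ` \<Union>F \<subseteq> U \<and> (\<forall>J\<in>F. h ` J \<in> sets borel)"
    then have F: "finite F" "disjoint F" "\<Union>F \<subseteq> {0..<1}" "h ` \<Union>F \<subseteq> U"
      "\<And>J. J \<in> F \<Longrightarrow> h ` J \<in> sets borel" by blast+
    have "(\<Sum>J\<in>F. emeasure lborel (h ` J)) = (\<integral>\<^sup>+y. (\<Sum>J\<in>F. indicator (h ` J) y) \<partial>lborel)"
      using F(5) by (subst nn_integral_sum) auto
    also have "\<dots> \<le> (\<integral>\<^sup>+y. N y * indicator U y \<partial>lborel)"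
    proof (intro nn_integral_mono)
      fix y
      show "(\<Sum>J\<in>F. indicator (h ` J) y) \<le> N y * indicator U y"
      proof (cases "y \<in> U")
        case True then show ?thesis using N(3)[OF F(1,2,3)] by simp
      next
        case False
        then have "(\<Sum>J\<in>F. indicator (h ` J) y) = (\<Sum>J\<in>F. 0 :: ennreal)"
          using F(4) by (intro sum.cong) (auto simp: indicator_def)
        then show ?thesis by simp
      qed
    qed
    also have "\<dots> = emeasure \<nu> U"
      using U(2) unfolding \<nu>_def by (subst emeasure_density) auto
    finally show "(\<Sum>J\<in>F. emeasure lborel (h ` J)) \<le> ennreal \<epsilon>" using U(3) by simp
  qed
qed

text \<open>A gauge around the points of \<open>A\<close> keeps the curve in a small ball and each
  coordinate in the neighbourhood from \<open>small_oscillation_cover\<close>; the covering lemma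
  turns it into nonoverlapping intervals. Over one interval the diameter of the curve is at most the
  sum of the lengths of the coordinate images, and over all intervals each coordinate contributes at
  most an equal share of \<epsilon>.\<close>

lemma hausdorff1_null_curve:
  fixes g :: "real \<Rightarrow> real^'n"
  assumes L: "L-lipschitz_on {0..1} g" and cont: "continuous_on UNIV g"
    and A: "A \<subseteq> {0..1}" and null: "\<And>i. negligible ((\<lambda>t. g t $ i) ` A)"
  shows "hausdorff1 (g ` A) = 0"
  unfolding hausdorff1_eq_0_iff
proof (intro allI impI)
  fix \<delta> \<epsilon> :: real assume "\<delta> > 0" "\<epsilon> > 0"
  define \<eta> where "\<eta> = \<epsilon> / CARD('n)"
  have "\<eta> > 0" using \<open>\<epsilon> > 0\<close> by (simp add: \<eta>_def)
  have Li: "L-lipschitz_on {0..1} (\<lambda>t. g t $ i)" for i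
    using L by (auto simp: lipschitz_on_def intro: order_trans[OF dist_vec_nth_le])
  have conti: "continuous_on UNIV (\<lambda>t. g t $ i)" for i
    using cont by (intro continuous_intros)
  have "\<forall>i. \<exists>U. open U \<and> (\<lambda>t. g t $ i) ` A \<subseteq> U \<and>
    (\<forall>F. finite F \<and> disjoint F \<and> \<Union>F \<subseteq> {0..<1} \<and> (\<lambda>t. g t $ i) ` \<Union>F \<subseteq> U \<and>
       (\<forall>J\<in>F. (\<lambda>t. g t $ i) ` J \<in> sets borel) \<longrightarrow>
       (\<Sum>J\<in>F. emeasure lborel ((\<lambda>t. g t $ i) ` J)) \<le> ennreal \<eta>)"
    by (rule allI, rule small_oscillation_cover[OF Li null \<open>\<eta> > 0\<close>])
  from choice[OF this] obtain W where "\<forall>i. open (W i) \<and> (\<lambda>t. g t $ i) ` A \<subseteq> W i \<and>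
    (\<forall>F. finite F \<and> disjoint F \<and> \<Union>F \<subseteq> {0..<1} \<and> (\<lambda>t. g t $ i) ` \<Union>F \<subseteq> W i \<and>
       (\<forall>J\<in>F. (\<lambda>t. g t $ i) ` J \<in> sets borel) \<longrightarrow>
       (\<Sum>J\<in>F. emeasure lborel ((\<lambda>t. g t $ i) ` J)) \<le> ennreal \<eta>)" ..
  then have W: "\<And>i. open (W i)" "\<And>i. (\<lambda>t. g t $ i) ` A \<subseteq> W i"
    "\<And>i F. finite F \<and> disjoint F \<and> \<Union>F \<subseteq> {0..<1} \<and> (\<lambda>t. g t $ i) ` \<Union>F \<subseteq> W i \<and>
       (\<forall>J\<in>F. (\<lambda>t. g t $ i) ` J \<in> sets borel) \<Longrightarrow>
       (\<Sum>J\<in>F. emeasure lborel ((\<lambda>t. g t $ i) ` J)) \<le> ennreal \<eta>"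
    by simp_all
  \<comment> \<open>A gauge has to be defined everywhere; \<open>UNIV\<close> off \<open>A\<close>
    is harmless because the covering lemma takes its tags in \<open>A\<close>. The radius
    \<open>\<delta>/2\<close> keeps diameters below \<delta>.\<close>
  define G where "G x = (if x \<in> A then g -` ball (g x) (\<delta>/2) \<inter> (\<Inter>i. (\<lambda>t. g t $ i) -` W i) else UNIV)" for x
  have "gauge G"
    unfolding gauge_def
  proof (intro allI conjI)
    fix x
    show "x \<in> G x" using W(2) \<open>\<delta> > 0\<close> by (auto simp: G_def)
    have "open (g -` ball (g x) (\<delta>/2))" using cont by (intro open_vimage) auto
    moreover have "open ((\<lambda>t. g t $ i) -` W i)" for i using conti W(1) by (intro open_vimage) auto
    ultimately show "open (G x)" by (simp add: G_def open_Int open_INT)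
  qed
  obtain \<D> where \<D>: "countable \<D>" "\<Union>\<D> \<subseteq> cbox 0 1"
    "\<And>K. K \<in> \<D> \<Longrightarrow> interior K \<noteq> {} \<and> (\<exists>c d. K = cbox c d)"
    "pairwise (\<lambda>A B. interior A \<inter> interior B = {}) \<D>"
    "\<And>K. K \<in> \<D> \<Longrightarrow> \<exists>x \<in> A \<inter> K. K \<subseteq> G x" "A \<subseteq> \<Union>\<D>"
    by (rule covering_lemma[of A 0 1 G]) (use A \<open>gauge G\<close> in auto)
  have KW: "(\<lambda>t. g t $ i) ` K \<subseteq> W i" if "K \<in> \<D>" for K i
    using \<D>(5)[OF that] by (auto simp: G_def)
  \<comment> \<open>Neighbouring intervals of \<open>\<D>\<close> may share an endpoint, whereas
    \<open>W(3)\<close> asks for disjoint sets; hence the lengths are taken over interiors.\<close>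
  have K: "bounded (g ` K)" "diameter (g ` K) \<le> \<delta>"
    "ennreal (diameter (g ` K)) \<le> (\<Sum>i\<in>UNIV. emeasure lborel ((\<lambda>t. g t $ i) ` interior K))"
    "(\<lambda>t. g t $ i) ` interior K \<in> sets borel"
    if KD: "K \<in> \<D>" for K i
  proof -
    obtain x where x: "x \<in> A" "x \<in> K" "g ` K \<subseteq> ball (g x) (\<delta>/2)"
      using \<D>(5)[OF KD] by (auto simp: G_def split: if_splits)
    show "bounded (g ` K)" using x(3) bounded_ball bounded_subset by blast
    have "diameter (g ` K) \<le> diameter (ball (g x) (\<delta>/2))"
      using x by (intro diameter_subset) auto
    then show "diameter (g ` K) \<le> \<delta>" using \<open>\<delta> > 0\<close> by simp
    obtain c d where cd: "K = {c..d}" "interior K = {c<..<d}" "c < d"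
      using \<D>(3)[OF KD] by (auto simp: interior_atLeastAtMost_real)
    have conn: "is_interval ((\<lambda>t. g t $ i) ` S)" if "connected S" for S i
      using that connected_continuous_image[OF continuous_on_subset[OF conti] that]
      by (auto simp: is_interval_connected_1)
    have meas: "(\<lambda>t. g t $ i) ` interior K \<in> sets borel" for i
      unfolding cd by (intro real_interval_borel_measurable conn) auto
    then show "(\<lambda>t. g t $ i) ` interior K \<in> sets borel" .
    let ?e = "\<lambda>i. emeasure lborel ((\<lambda>t. g t $ i) ` interior K)"
    \<comment> \<open>By the intermediate value theorem the coordinate takes all values between
      those at \<open>s\<close> and \<open>t\<close>. Passing to the interior of \<open>K\<close>
      loses at most the two endpoint values, a null set.\<close>
    have comp: "ennreal \<bar>g s $ i - g t $ i\<bar> \<le> ?e i" if "s \<in> K" "t \<in> K" for s t i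
    proof -
      let ?h = "\<lambda>t. g t $ i"
      have "{min (?h s) (?h t) .. max (?h s) (?h t)} \<subseteq> ?h ` K"
        using conn[of K i] that cd(1) unfolding is_interval_1 min_def max_def by auto
      also have "\<dots> \<subseteq> ?h ` interior K \<union> {?h c, ?h d}"
      proof -
        have "K \<subseteq> interior K \<union> {c, d}" using cd by auto
        then show ?thesis by blast
      qed
      finally have "{min (?h s) (?h t) .. max (?h s) (?h t)} \<subseteq> \<dots>" .
      then have "emeasure lborel {min (?h s) (?h t) .. max (?h s) (?h t)} \<le> emeasure lborel (?h ` interior K \<union> {?h c, ?h d})"
        using meas by (intro emeasure_mono) auto
      also have "\<dots> = ?e i"
        using meas by (intro emeasure_Un_null_set) (auto intro: countable_imp_null_set_lborel)
      also have "emeasure lborel {min (?h s) (?h t) .. max (?h s) (?h t)} = ennreal \<bar>?h s - ?h t\<bar>"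
        by (auto simp: min_def max_def)
      finally show ?thesis .
    qed
    show "ennreal (diameter (g ` K)) \<le> (\<Sum>i\<in>UNIV. ?e i)"
    proof (cases "(\<Sum>i\<in>UNIV. ?e i) = top")
      case False
      then obtain r where r: "(\<Sum>i\<in>UNIV. ?e i) = ennreal r" "r \<ge> 0"
        by (cases "(\<Sum>i\<in>UNIV. ?e i)") auto
      have "diameter (g ` K) \<le> r"
      proof (intro diameter_le)
        show "g ` K \<noteq> {} \<or> 0 \<le> r" using r by simp
        fix u v assume "u \<in> g ` K" "v \<in> g ` K"
        then obtain s t where st: "s \<in> K" "t \<in> K" "u = g s" "v = g t" by blast
        have "norm (u - v) \<le> (\<Sum>i\<in>UNIV. \<bar>g s $ i - g t $ i\<bar>)"
          using norm_le_l1_cart[of "u - v"] st by simp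
        then have "ennreal (norm (u - v)) \<le> (\<Sum>i\<in>UNIV. ennreal \<bar>g s $ i - g t $ i\<bar>)"
          by (simp add: ennreal_leI)
        also have "\<dots> \<le> ennreal r"
          unfolding r(1)[symmetric] using st by (intro sum_mono comp)
        finally show "norm (u - v) \<le> r" using r(2) by simp
      qed
      then show ?thesis using r by (simp add: ennreal_leI)
    qed (metis top_greatest)
  qed
  have fsum: "(\<Sum>K\<in>F. ennreal (diameter (g ` K))) \<le> ennreal \<epsilon>" if F: "finite F" "F \<subseteq> \<D>" for F
  proof -
    \<comment> \<open>\<open>W(3)\<close> speaks of a set of pieces, so the sum is reindexed by
      interiors. These are nonempty and pairwise disjoint, hence distinct.\<close>
    have inj: "inj_on interior F"
    proof (rule inj_onI, rule ccontr)
      fix J K assume "J \<in> F" "K \<in> F" "interior J = interior K" "J \<noteq> K"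
      moreover from this have "interior J \<inter> interior K = {}"
        using F(2) by (intro pairwiseD[OF \<D>(4)]) auto
      ultimately show False using \<D>(3)[of J] F(2) by auto
    qed
    have "(\<Sum>K\<in>F. ennreal (diameter (g ` K))) \<le> (\<Sum>K\<in>F. \<Sum>i\<in>UNIV. emeasure lborel ((\<lambda>t. g t $ i) ` interior K))"
      using F by (intro sum_mono K) auto
    also have "\<dots> = (\<Sum>i\<in>UNIV. \<Sum>K\<in>F. emeasure lborel ((\<lambda>t. g t $ i) ` interior K))"
      by (rule sum.swap)
    also have "\<dots> = (\<Sum>i\<in>UNIV. \<Sum>J\<in>interior ` F. emeasure lborel ((\<lambda>t. g t $ i) ` J))"
      by (simp add: sum.reindex[OF inj])
    also have "\<dots> \<le> (\<Sum>i\<in>(UNIV::'n set). ennreal \<eta>)"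
    proof (intro sum_mono W(3) conjI)
      fix i
      show "finite (interior ` F)" using F by simp
      show "disjoint (interior ` F)"
        by (rule pairwise_imageI) (use pairwiseD[OF \<D>(4)] F(2) in \<open>auto simp: disjnt_def\<close>)
      show "\<Union> (interior ` F) \<subseteq> {0..<1}"
      proof
        fix t assume "t \<in> \<Union> (interior ` F)"
        then obtain J where J: "J \<in> \<D>" "t \<in> interior J" using F by blast
        then have "interior J \<subseteq> interior {0..1}"
          using \<D>(2) by (intro interior_mono) auto
        then show "t \<in> {0..<1}" using J by (auto simp: interior_atLeastAtMost_real)
      qed
      show "(\<lambda>t. g t $ i) ` \<Union> (interior ` F) \<subseteq> W i"
        using KW F(2) interior_subset by blast
      show "\<forall>J\<in>interior ` F. (\<lambda>t. g t $ i) ` J \<in> sets borel"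
        using K(4) F(2) by blast
    qed
    also have "\<dots> = ennreal \<epsilon>"
      using \<open>\<epsilon> > 0\<close> by (subst sum_ennreal) (auto simp: \<eta>_def)
    finally show ?thesis .
  qed
  \<comment> \<open>\<open>\<D>\<close> may be finite; indices that encode no interval get the empty
    set, of diameter 0.\<close>
  define C where "C n = (if n \<in> to_nat_on \<D> ` \<D> then g ` from_nat_into \<D> n else {})" for n
  have C1: "C (to_nat_on \<D> K) = g ` K" if "K \<in> \<D>" for K
    using that \<D>(1) by (simp add: C_def)
  have "g ` A \<subseteq> (\<Union>n. C n)"
  proof
    fix y assume "y \<in> g ` A"
    then obtain K where "K \<in> \<D>" "y \<in> g ` K" using \<D>(6) by blast
    then show "y \<in> (\<Union>n. C n)" using C1 by blast
  qed
  moreover have "bounded (C n) \<and> diameter (C n) \<le> \<delta>" for n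
    using K(1,2) C1 \<open>\<delta> > 0\<close> by (cases "n \<in> to_nat_on \<D> ` \<D>") (auto simp: C_def)
  moreover have "(\<Sum>n. ennreal (diameter (C n))) \<le> ennreal \<epsilon>"
  proof (rule suminf_le_const)
    fix n
    \<comment> \<open>Each partial sum involves only finitely many intervals, so the bound
      \<open>fsum\<close> for finite subfamilies passes to the series.\<close>
    define F where "F = {K \<in> \<D>. to_nat_on \<D> K < n}"
    have inj: "inj_on (to_nat_on \<D>) F"
      using inj_on_to_nat_on[OF \<D>(1)] by (rule inj_on_subset) (auto simp: F_def)
    have "finite (to_nat_on \<D> ` F)" by (rule finite_subset[of _ "{..<n}"]) (auto simp: F_def)
    then have "finite F" using inj by (rule finite_imageD)
    have "(\<Sum>m<n. ennreal (diameter (C m))) = (\<Sum>m\<in>to_nat_on \<D> ` F. ennreal (diameter (C m)))"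
      by (rule sum.mono_neutral_right) (auto simp: F_def C_def)
    also have "\<dots> = (\<Sum>K\<in>F. ennreal (diameter (g ` K)))"
      using C1 by (subst sum.reindex[OF inj]) (auto simp: F_def intro!: sum.cong)
    also have "\<dots> \<le> ennreal \<epsilon>" using \<open>finite F\<close> by (intro fsum) (auto simp: F_def)
    finally show "(\<Sum>m<n. ennreal (diameter (C m))) \<le> ennreal \<epsilon>" .
  qed simp
  ultimately show "\<exists>C. g ` A \<subseteq> (\<Union>i::nat. C i) \<and> (\<forall>i. bounded (C i) \<and> diameter (C i) \<le> \<delta>) \<and>
       (\<Sum>i. ennreal (diameter (C i))) \<le> ennreal \<epsilon>"
    by blast
qed

section \<open>Maps that locally expand distances\<close>

lemma C1_onI:
  assumes "\<And>x. x \<in> U \<Longrightarrow> (f has_derivative blinfun_apply (f' x)) (at x)" "continuous_on U f'"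
  shows "C1_on U f"
  unfolding C1_on_def using assms by blast

lemma C2_on_imp_C1_on:
  assumes "C2_on U f"
  shows "C1_on U f"
proof -
  obtain f' where f': "\<And>x. x \<in> U \<Longrightarrow> (f has_derivative blinfun_apply (f' x)) (at x)" "C1_on U f'"
    using assms unfolding C2_on_def by blast
  have "continuous_on U f'"
  proof (rule continuous_at_imp_continuous_on, rule ballI)
    fix x assume "x \<in> U"
    then obtain D where "(f' has_derivative D) (at x)"
      using f'(2) unfolding C1_on_def by blast
    then show "isCont f' x" by (rule has_derivative_continuous)
  qed
  with f'(1) show ?thesis by (rule C1_onI)
qed

lemma C1_on_compose:
  assumes F: "C1_on U F" and G: "C1_on V G" and sub: "G ` V \<subseteq> U"
  shows "C1_on V (F \<circ> G)"
proof -
  obtain F' where F': "\<And>x. x \<in> U \<Longrightarrow> (F has_derivative blinfun_apply (F' x)) (at x)" "continuous_on U F'"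
    using F unfolding C1_on_def by blast
  obtain G' where G': "\<And>x. x \<in> V \<Longrightarrow> (G has_derivative blinfun_apply (G' x)) (at x)" "continuous_on V G'"
    using G unfolding C1_on_def by blast
  have "continuous_on V G"
    using G'(1) by (intro continuous_at_imp_continuous_on ballI) (rule has_derivative_continuous)
  then have "continuous_on V (\<lambda>x. F' (G x))"
    using continuous_on_compose2[OF F'(2) _ sub] by blast
  then have "continuous_on V (\<lambda>x. F' (G x) o\<^sub>L G' x)"
    using G'(2) by (rule bounded_bilinear.continuous_on[OF bounded_bilinear_blinfun_compose])
  moreover have "(F \<circ> G has_derivative blinfun_apply (F' (G x) o\<^sub>L G' x)) (at x)" if "x \<in> V" for x
  proof -
    have "(F has_derivative blinfun_apply (F' (G x))) (at (G x))" using that sub by (intro F') auto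
    from diff_chain_at[OF G'(1)[OF that] this] show ?thesis
      by (simp add: blinfun_compose.rep_eq)
  qed
  ultimately show ?thesis by (rule C1_onI[rotated])
qed

lemma C1_on_vec_lambda:
  fixes f :: "'n::finite \<Rightarrow> 'a::real_normed_vector \<Rightarrow> real"
  assumes "\<And>i. C1_on U (f i)"
  shows "C1_on U (\<lambda>x. \<chi> i. f i x)"
proof -
  have "\<forall>i. \<exists>f'. (\<forall>x\<in>U. (f i has_derivative blinfun_apply (f' x)) (at x)) \<and> continuous_on U f'"
    using assms unfolding C1_on_def by blast
  then obtain f' where f': "\<And>i x. x \<in> U \<Longrightarrow> (f i has_derivative blinfun_apply (f' i x)) (at x)"
      "\<And>i. continuous_on U (f' i)"
    by metis
  \<comment> \<open>The embeddings of the coordinate axes. Writing the derivative as a finite sum of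
    compositions with them reduces operator-norm continuity to that of the components.\<close>
  define e :: "'n \<Rightarrow> real \<Rightarrow>\<^sub>L (real^'n)" where "e i = Blinfun (\<lambda>r. r *\<^sub>R axis i 1)" for i
  have e: "blinfun_apply (e i) r = r *\<^sub>R axis i 1" for i r
    unfolding e_def by (subst bounded_linear_Blinfun_apply) (auto intro: bounded_linear_intros)
  have vec: "(\<chi> i. g i) = (\<Sum>i\<in>UNIV. g i *\<^sub>R axis i 1)" for g :: "'n \<Rightarrow> real"
    by (simp add: vec_eq_iff sum_component axis_def if_distrib cong: if_cong)
  have "((\<lambda>x. \<chi> i. f i x) has_derivative blinfun_apply (\<Sum>i\<in>UNIV. e i o\<^sub>L f' i x)) (at x)"
    if "x \<in> U" for x
  proof -
    have "((\<lambda>x. \<Sum>i\<in>UNIV. f i x *\<^sub>R axis i 1) has_derivative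
        (\<lambda>h. \<Sum>i\<in>UNIV. blinfun_apply (f' i x) h *\<^sub>R (axis i 1 :: real^'n))) (at x)"
      using f'(1)[OF that] by (intro has_derivative_sum has_derivative_scaleR_left)
    moreover have "blinfun_apply (\<Sum>i\<in>UNIV. e i o\<^sub>L f' i x) =
        (\<lambda>h. \<Sum>i\<in>UNIV. blinfun_apply (f' i x) h *\<^sub>R (axis i 1 :: real^'n))"
      by (rule ext) (simp add: blinfun.sum_left e)
    ultimately show ?thesis unfolding vec by simp
  qed
  moreover have "continuous_on U (\<lambda>x. \<Sum>i\<in>UNIV. e i o\<^sub>L f' i x)"
    using f'(2) by (intro continuous_on_sum bounded_bilinear.continuous_on[OF bounded_bilinear_blinfun_compose]
        continuous_on_const)
  ultimately show ?thesis by (rule C1_onI)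
qed

lemma C1_on_lipschitz_on_compact:
  assumes "C1_on U F" "compact K" "convex K" "K \<subseteq> U"
  obtains B where "B > 0" "B-lipschitz_on K F"
proof -
  obtain F' where F': "\<And>x. x \<in> U \<Longrightarrow> (F has_derivative blinfun_apply (F' x)) (at x)" "continuous_on U F'"
    using assms(1) unfolding C1_on_def by blast
  have "compact (F' ` K)"
    using assms F'(2) by (intro compact_continuous_image) (auto intro: continuous_on_subset)
  then have "bounded (F' ` K)" by (rule compact_imp_bounded)
  then obtain B where "B > 0" "\<forall>y\<in>F' ` K. norm y \<le> B" unfolding bounded_pos by blast
  then have B: "norm (F' x) \<le> B" if "x \<in> K" for x using that by simp
  have "B-lipschitz_on K F"
  proof (rule lipschitz_onI)
    fix x y assume xy: "x \<in> K" "y \<in> K"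
    have der: "(F has_derivative blinfun_apply (F' z)) (at z within K)" if "z \<in> K" for z
      using that assms(4) by (intro has_derivative_at_withinI[OF F'(1)]) auto
    have bd: "onorm (blinfun_apply (F' z)) \<le> B" if "z \<in> K" for z
      using B[OF that] by (simp only: norm_blinfun.rep_eq)
    show "dist (F x) (F y) \<le> B * dist x y"
      unfolding dist_norm by (rule differentiable_bound[OF assms(3) der bd xy])
  qed (use \<open>B > 0\<close> in simp)
  with \<open>B > 0\<close> show thesis by (rule that)
qed

text \<open>In finite dimension, injectivity on \<open>S\<close> gives
  \<open>e * norm v \<le> norm (D v)\<close> there. Near \<open>p\<close> the derivative differs
  from \<open>D\<close> by at most \<open>e/2\<close>, so \<open>F\<close> deviates from
  \<open>D\<close> by an \<open>e/2\<close>-Lipschitz error and still expands by \<open>e/2\<close>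
  in the directions of \<open>S\<close>.\<close>

lemma C1_on_expanding:
  fixes F :: "'a::euclidean_space \<Rightarrow> 'b::euclidean_space"
  assumes "open U" "C1_on U F" "p \<in> U" and D: "(F has_derivative D) (at p)"
    and "subspace S" and inj: "\<And>v. v \<in> S \<Longrightarrow> D v = 0 \<Longrightarrow> v = 0"
  obtains c r where "c > 0" "r > 0"
    "\<And>x y. x \<in> ball p r \<Longrightarrow> y \<in> ball p r \<Longrightarrow> x - y \<in> S \<Longrightarrow> c * dist x y \<le> dist (F x) (F y)"
proof -
  obtain F' where F': "\<And>x. x \<in> U \<Longrightarrow> (F has_derivative blinfun_apply (F' x)) (at x)" "continuous_on U F'"
    using assms(2) unfolding C1_on_def by blast
  have DF: "D = blinfun_apply (F' p)"
    using D F'(1)[OF \<open>p \<in> U\<close>] by (rule has_derivative_unique)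
  obtain e where e: "e > 0" "\<And>v. v \<in> S \<Longrightarrow> e * norm v \<le> norm (D v)"
    using injective_imp_isometric[of S D] inj closed_subspace[OF \<open>subspace S\<close>] \<open>subspace S\<close>
      has_derivative_bounded_linear[OF D] by blast
  have "isCont F' p" using F'(2) \<open>open U\<close> \<open>p \<in> U\<close> by (simp add: continuous_on_eq_continuous_at)
  then obtain s where s: "s > 0" "\<And>x. dist x p < s \<Longrightarrow> dist (F' x) (F' p) < e/2"
    unfolding continuous_at_eps_delta using e(1) by (metis half_gt_zero)
  obtain t where t: "t > 0" "ball p t \<subseteq> U" using \<open>open U\<close> \<open>p \<in> U\<close> openE by blast
  define r where "r = min s t"
  show thesis
  proof (rule that)
    show "e/2 > 0" "r > 0" using e s t by (auto simp: r_def)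
    fix x y assume xy: "x \<in> ball p r" "y \<in> ball p r" "x - y \<in> S"
    have "norm (F x - F y - D (x - y)) \<le> norm (x - y) * (e/2)"
      unfolding DF
    proof (rule differentiable_bound_linearization[where S = "ball p r" and f' = "\<lambda>x. blinfun_apply (F' x)"])
      fix u :: real assume "u \<in> {0..1}"
      then have "(1 - u) *\<^sub>R y + u *\<^sub>R x \<in> ball p r"
        using convex_ball[of p r] xy unfolding convex_alt by auto
      then show "y + u *\<^sub>R (x - y) \<in> ball p r" by (simp add: algebra_simps)
    next
      fix z assume "z \<in> ball p r"
      then have "z \<in> U" "dist z p < s" using t by (auto simp: r_def dist_commute)
      then show "(F has_derivative blinfun_apply (F' z)) (at z within ball p r)"
        by (intro has_derivative_at_withinI[OF F'(1)])
      have "onorm (blinfun_apply (F' z) - blinfun_apply (F' p)) = norm (F' z - F' p)"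
        by (simp add: norm_blinfun.rep_eq fun_diff_def minus_blinfun.rep_eq)
      then show "onorm (blinfun_apply (F' z) - blinfun_apply (F' p)) \<le> e/2"
        using s(2)[OF \<open>dist z p < s\<close>] by (simp add: dist_norm)
    qed (use s t in \<open>auto simp: r_def\<close>)
    moreover have "norm (D (x - y)) \<le> norm (F x - F y) + norm (F x - F y - D (x - y))"
      by (metis add.commute norm_minus_commute norm_triangle_sub)
    ultimately show "e/2 * dist x y \<le> dist (F x) (F y)"
      using e(2)[OF xy(3)] by (simp add: dist_norm algebra_simps)
  qed
qed

text \<open>A nonzero kernel vector, extended to a basis of \<open>S\<close>, would let the image be
  spanned by one vector fewer than \<open>dim S\<close>.\<close>

lemma linear_injective_on_subspace_if_dim_image:
  fixes D :: "'a::euclidean_space \<Rightarrow> 'b::euclidean_space"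
  assumes "linear D" "subspace S" "dim S \<le> dim (D ` S)" "v \<in> S" "D v = 0"
  shows "v = 0"
proof (rule ccontr)
  assume "v \<noteq> 0"
  then obtain B where B: "{v} \<subseteq> B" "B \<subseteq> S" "independent B" "S \<subseteq> span B"
    using maximal_independent_subset_extend[of "{v}" S] \<open>v \<in> S\<close> by auto
  have fin: "finite B" using B(3) by (rule independent_imp_finite)
  have card: "card B = dim S" using B by (intro basis_card_eq_dim) auto
  have "D ` S \<subseteq> span (D ` (B - {v}))"
  proof -
    have "D ` S \<subseteq> D ` span B" using B(4) by blast
    also have "\<dots> = span (D ` B)" using \<open>linear D\<close> by (simp add: linear_span_image)
    also have "\<dots> = span (insert 0 (D ` (B - {v})))"
      using B(1) \<open>D v = 0\<close> by (metis image_insert insert_Diff insert_subset)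
    finally show ?thesis by simp
  qed
  then have "dim (D ` S) \<le> card (D ` (B - {v}))" using fin by (intro dim_le_card) auto
  also have "\<dots> \<le> card (B - {v})" using fin by (intro card_image_le) auto
  also have "\<dots> < card B" using fin B(1) by (intro psubset_card_mono) auto
  finally show False using assms(3) card by simp
qed

text \<open>The component \<open>z\<close> of \<open>v\<close> orthogonal to \<open>S\<close>
  satisfies \<open>z \<bullet> g s = 0\<close> near \<open>t\<close>; differentiating gives
  \<open>z \<bullet> v = 0\<close>, so \<open>z\<close> is zero.\<close>

lemma derivative_in_subspace:
  fixes g :: "real \<Rightarrow> 'a::euclidean_space"
  assumes g: "(g has_vector_derivative v) (at t)" and S: "subspace S"
    and ev: "\<forall>\<^sub>F s in nhds t. g s \<in> S"
  shows "v \<in> S"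
proof -
  obtain y z where yz: "y \<in> span S" "\<And>w. w \<in> span S \<Longrightarrow> orthogonal z w" "v = y + z"
    by (rule orthogonal_subspace_decomp_exists[of S v]) blast
  have "((\<lambda>s. z \<bullet> g s) has_real_derivative z \<bullet> v) (at t)"
    using bounded_linear.has_vector_derivative[OF bounded_linear_inner_right g]
    by (simp add: has_real_derivative_iff_has_vector_derivative)
  moreover have "\<forall>\<^sub>F s in nhds t. z \<bullet> g s = 0"
    using ev by eventually_elim (use yz(2) span_base in \<open>auto simp: orthogonal_def\<close>)
  ultimately have "((\<lambda>s. 0) has_real_derivative z \<bullet> v) (at t)"
    by (subst (asm) DERIV_cong_ev[OF refl _ refl]) auto
  then have "z \<bullet> v = 0" by (metis DERIV_unique DERIV_const)
  moreover have "z \<bullet> y = 0" using yz(1,2) by (auto simp: orthogonal_def)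
  ultimately have "z = 0" using yz(3) by (simp add: inner_add_right)
  then show ?thesis using yz(1,3) span_minimal[OF order_refl S] by auto
qed

text \<open>A chart flattens \<open>M\<close> to the subspace \<open>S\<close>. The rank condition
  on the tangent space makes the derivative of \<open>H \<circ> \<Psi>\<close> injective on
  \<open>S\<close>, so this composition expands along \<open>S\<close>, and the estimate is carried
  back to \<open>M\<close>.\<close>

lemma submanifold_expanding:
  fixes H :: "'a::euclidean_space \<Rightarrow> 'b::euclidean_space"
  assumes H: "C1_on UNIV H" and M: "C1_submanifold k M" and "x \<in> M"
    and D: "(H has_derivative D) (at x)" and dim: "k \<le> dim (D ` tangent_space M x)"
  obtains c r where "c > 0" "r > 0"
    "\<And>y z. y \<in> M \<inter> ball x r \<Longrightarrow> z \<in> M \<inter> ball x r \<Longrightarrow> c * dist y z \<le> dist (H y) (H z)"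
proof -
  obtain U V S and \<Phi> \<Psi> :: "'a \<Rightarrow> 'a" where chart: "open U" "open V" "x \<in> U" "homeomorphism U V \<Phi> \<Psi>"
    "C1_on U \<Phi>" "C1_on V \<Psi>" "subspace S" "dim S = k" "\<Phi> ` (U \<inter> M) = V \<inter> S"
    using M \<open>x \<in> M\<close> unfolding C1_submanifold_def by metis
  define p where "p = \<Phi> x"
  have "p \<in> V" "\<Psi> p = x"
    using chart by (auto simp: p_def homeomorphism_def)
  obtain D\<Phi> where D\<Phi>: "(\<Phi> has_derivative D\<Phi>) (at x)"
    using chart(3,5) unfolding C1_on_def by blast
  obtain D\<Psi> where D\<Psi>: "(\<Psi> has_derivative D\<Psi>) (at p)"
    using \<open>p \<in> V\<close> chart(6) unfolding C1_on_def by blast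
  have "(\<Psi> \<circ> \<Phi> has_derivative D\<Psi> \<circ> D\<Phi>) (at x)"
    using diff_chain_at[OF D\<Phi>] D\<Psi> by (simp add: p_def)
  moreover have "(\<Psi> \<circ> \<Phi> has_derivative id) (at x)"
  proof (rule has_derivative_transform_within_open[OF has_derivative_id chart(1,3)])
    show "id y = (\<Psi> \<circ> \<Phi>) y" if "y \<in> U" for y
      using chart(4) that by (simp add: homeomorphism_def)
  qed
  ultimately have inv: "D\<Psi> \<circ> D\<Phi> = id" by (rule has_derivative_unique)
  \<comment> \<open>The chart sends a curve in \<open>M\<close> to a curve lying in \<open>S\<close>
    near time 0, so its velocity \<open>D\<Phi> v\<close> is in \<open>S\<close>, and
    \<open>D\<Psi>\<close> returns \<open>v\<close>.\<close>
  have tan: "tangent_space M x \<subseteq> D\<Psi> ` S"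
  proof
    fix v assume "v \<in> tangent_space M x"
    then obtain \<gamma> \<epsilon> where \<gamma>: "\<epsilon> > 0" "\<gamma> ` {-\<epsilon><..<\<epsilon>} \<subseteq> M" "\<gamma> 0 = x"
      "(\<gamma> has_vector_derivative v) (at 0)"
      unfolding tangent_space_def by blast
    have "(\<Phi> \<circ> \<gamma> has_derivative D\<Phi> \<circ> (\<lambda>h. h *\<^sub>R v)) (at 0)"
      using \<gamma>(3,4) D\<Phi> by (intro diff_chain_at) (simp_all add: has_vector_derivative_def)
    then have "((\<Phi> \<circ> \<gamma>) has_vector_derivative D\<Phi> v) (at 0)"
      using has_derivative_linear[OF D\<Phi>]
      by (simp add: has_vector_derivative_def comp_def linear_cmul)
    moreover have "\<forall>\<^sub>F s in nhds 0. (\<Phi> \<circ> \<gamma>) s \<in> S"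
    proof -
      have "isCont \<gamma> 0" using \<gamma>(4) by (rule has_vector_derivative_continuous)
      then have "\<forall>\<^sub>F s in nhds 0. \<gamma> s \<in> U"
        using chart(1,3) \<gamma>(3) unfolding isCont_def tendsto_def
        by (auto simp: eventually_at_filter elim: eventually_mono)
      moreover have "\<forall>\<^sub>F s in nhds 0. s \<in> {-\<epsilon><..<\<epsilon>}"
        using \<gamma>(1) by (intro eventually_nhds_in_open) auto
      ultimately show ?thesis
      proof eventually_elim
        case (elim s)
        then have "\<gamma> s \<in> U \<inter> M" using \<gamma>(2) by blast
        then have "\<Phi> (\<gamma> s) \<in> V \<inter> S" unfolding chart(9)[symmetric] by (rule imageI)
        then show ?case by simp
      qed
    qed
    ultimately have "D\<Phi> v \<in> S" using chart(7) by (intro derivative_in_subspace)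
    moreover have "v = D\<Psi> (D\<Phi> v)" using inv by (metis comp_apply id_apply)
    ultimately show "v \<in> D\<Psi> ` S" by blast
  qed
  have C1: "C1_on V (H \<circ> \<Psi>)" using H chart(6) by (rule C1_on_compose) simp
  have D': "(H \<circ> \<Psi> has_derivative D \<circ> D\<Psi>) (at p)"
    using D\<Psi> D \<open>\<Psi> p = x\<close> by (intro diff_chain_at) simp_all
  have "D ` tangent_space M x \<subseteq> (D \<circ> D\<Psi>) ` S"
    using tan by (auto simp: image_comp)
  then have "dim S \<le> dim ((D \<circ> D\<Psi>) ` S)" using dim dim_subset chart(8) le_trans by blast
  then obtain c r1 where c: "c > 0" "r1 > 0"
    "\<And>q q'. q \<in> ball p r1 \<Longrightarrow> q' \<in> ball p r1 \<Longrightarrow> q - q' \<in> S \<Longrightarrow>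
       c * dist q q' \<le> dist ((H \<circ> \<Psi>) q) ((H \<circ> \<Psi>) q')"
    using C1_on_expanding[OF chart(2) C1 \<open>p \<in> V\<close> D' chart(7)]
      linear_injective_on_subspace_if_dim_image[OF has_derivative_linear[OF D'] chart(7)] by metis
  obtain r2 where r2: "r2 > 0" "cball p r2 \<subseteq> V"
    using chart(2) \<open>p \<in> V\<close> open_contains_cball by blast
  \<comment> \<open>Distances in \<open>M\<close> are at most \<open>B\<close> times distances in
    the chart, whence the final constant \<open>c / B\<close>.\<close>
  obtain B where B: "B > 0" "B-lipschitz_on (cball p r2) \<Psi>"
    using C1_on_lipschitz_on_compact[OF chart(6) _ _ r2(2)] by auto
  have "isCont \<Phi> x" using D\<Phi> by (rule has_derivative_continuous)
  then obtain s where s: "s > 0" "\<And>y. dist y x < s \<Longrightarrow> dist (\<Phi> y) p < min r1 r2"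
    unfolding continuous_at_eps_delta p_def using c(2) r2(1) by (metis min_less_iff_conj)
  obtain t where t: "t > 0" "ball x t \<subseteq> U" using chart(1,3) openE by blast
  show thesis
  proof (rule that)
    show "c / B > 0" "min s t > 0" using c B s t by auto
    fix y z assume yz: "y \<in> M \<inter> ball x (min s t)" "z \<in> M \<inter> ball x (min s t)"
    then have U: "y \<in> U \<inter> M" "z \<in> U \<inter> M" using t(2) by auto
    then have "\<Phi> y \<in> S" "\<Phi> z \<in> S" using chart(9) by blast+
    then have S: "\<Phi> y - \<Phi> z \<in> S" by (rule subspace_diff[OF chart(7)])
    have id: "\<Psi> (\<Phi> y) = y" "\<Psi> (\<Phi> z) = z" using chart(4) U by (auto simp: homeomorphism_def)
    have near: "dist (\<Phi> y) p < min r1 r2" "dist (\<Phi> z) p < min r1 r2"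
      using s(2)[of y] s(2)[of z] yz by (simp_all add: dist_commute)
    have "dist y z \<le> B * dist (\<Phi> y) (\<Phi> z)"
      using lipschitz_onD[OF B(2), of "\<Phi> y" "\<Phi> z"] near id by (simp add: dist_commute)
    then have "c / B * dist y z \<le> c / B * (B * dist (\<Phi> y) (\<Phi> z))"
      using c(1) B(1) by (intro mult_left_mono) auto
    also have "\<dots> = c * dist (\<Phi> y) (\<Phi> z)" using B(1) by simp
    also have "\<dots> \<le> dist (H y) (H z)"
      using c(3)[of "\<Phi> y" "\<Phi> z"] near S id by (simp add: dist_commute)
    finally show "c / B * dist y z \<le> dist (H y) (H z)" .
  qed
qed

section \<open>Rectifiable sets and admissible tuples\<close>

text \<open>Up to a null set, \<open>X\<close> is cut into countably many pieces on Lipschitz arcs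
  over unit intervals. Composed with \<open>H\<close>, such an arc meets the hypotheses of
  \<open>hausdorff1_null_curve\<close>, and expansion brings nullity back from the image to the
  piece.\<close>

lemma hausdorff1_null_of_expanding_projections:
  fixes X :: "(real^'d) set" and H :: "real^'d \<Rightarrow> real^'n"
  assumes rect: "rectifiable1 E" "X \<subseteq> E"
    and H: "C1_on UNIV H" and null: "\<And>i. hausdorff1 ((\<lambda>x. H x $ i) ` X) = 0"
    and "c > 0" and exp: "\<And>x y. x \<in> X \<Longrightarrow> y \<in> X \<Longrightarrow> c * dist x y \<le> dist (H x) (H y)"
  shows "hausdorff1 X = 0"
proof -
  obtain f :: "nat \<Rightarrow> real \<Rightarrow> real^'d" where f: "\<forall>j. \<exists>L. L-lipschitz_on UNIV (f j)"
    "hausdorff1 (E - (\<Union>j. range (f j))) = 0"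
    using rect(1) unfolding rectifiable1_def by blast
  have null': "hausdorff1 (X \<inter> f j ` {of_int m..of_int m + 1}) = 0" for j and m :: int
  proof -
    obtain L where L: "L-lipschitz_on UNIV (f j)" using f(1) by blast
    define p where "p t = f j (of_int m + t)" for t
    have p: "L-lipschitz_on {0..1} p"
    proof (rule lipschitz_onI)
      show "dist (p s) (p t) \<le> L * dist s t" for s t
        using lipschitz_onD[OF L UNIV_I UNIV_I, of "of_int m + s" "of_int m + t"]
        by (simp add: p_def dist_real_def)
    qed (rule lipschitz_on_nonneg[OF L])
    have pc: "continuous_on UNIV p"
      unfolding p_def
      by (intro continuous_on_compose2[OF lipschitz_on_continuous_on[OF L]] continuous_intros) auto
    have Hc: "continuous_on UNIV H"
    proof -
      obtain H' where "\<And>x. (H has_derivative blinfun_apply (H' x)) (at x)"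
        using H unfolding C1_on_def by blast
      then show ?thesis
        by (intro continuous_at_imp_continuous_on ballI) (rule has_derivative_continuous)
    qed
    have "compact (p ` {0..1})"
      using pc by (intro compact_continuous_image) (auto intro: continuous_on_subset)
    then have "bounded (p ` {0..1})" by (rule compact_imp_bounded)
    then obtain R where "\<forall>y\<in>p ` {0..1}. norm y \<le> R" unfolding bounded_iff by blast
    then have R: "p ` {0..1} \<subseteq> cball 0 R" by auto
    \<comment> \<open>A continuously differentiable \<open>H\<close> is Lipschitz on compact convex
      sets, so it is restricted to a ball containing the compact arc.\<close>
    obtain B where B: "B-lipschitz_on (cball 0 R) H"
      using C1_on_lipschitz_on_compact[OF H compact_cball convex_cball] by blast
    define A where "A = {t \<in> {0..1}. p t \<in> X}"
    have "hausdorff1 ((H \<circ> p) ` A) = 0"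
    proof (rule hausdorff1_null_curve)
      show "(B * L)-lipschitz_on {0..1} (H \<circ> p)"
        using p lipschitz_on_subset[OF B R] by (rule lipschitz_on_compose)
      show "continuous_on UNIV (H \<circ> p)"
        using pc Hc by (intro continuous_on_compose) (auto intro: continuous_on_subset)
      show "A \<subseteq> {0..1}" by (auto simp: A_def)
      fix i
      have "(\<lambda>t. (H \<circ> p) t $ i) ` A \<subseteq> (\<lambda>x. H x $ i) ` X" by (auto simp: A_def)
      then show "negligible ((\<lambda>t. (H \<circ> p) t $ i) ` A)"
        using null by (intro negligible_if_hausdorff1_null) (rule hausdorff1_null_subset)
    qed
    then have "hausdorff1 (H ` (p ` A)) = 0" by (simp add: image_comp)
    then have "hausdorff1 (p ` A) = 0"
      using \<open>c > 0\<close> exp by (intro hausdorff1_null_expanding[of c "p ` A" H]) (auto simp: A_def)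
    moreover have "X \<inter> f j ` {of_int m..of_int m + 1} \<subseteq> p ` A"
    proof
      fix x assume x: "x \<in> X \<inter> f j ` {of_int m..of_int m + 1}"
      then obtain t where t: "t \<in> {of_int m..of_int m + 1}" "x = f j t" by blast
      then have "t - of_int m \<in> A" "x = p (t - of_int m)" using x by (auto simp: A_def p_def)
      then show "x \<in> p ` A" by blast
    qed
    ultimately show ?thesis by (rule hausdorff1_null_subset)
  qed
  \<comment> \<open>\<open>None\<close> indexes the part of \<open>E\<close> missed by all curves,
    \<open>Some (j, m)\<close> the piece on the arc of \<open>f j\<close> over
    \<open>[m, m+1]\<close>.\<close>
  define S where "S i = (case i of None \<Rightarrow> E - (\<Union>j. range (f j))
    | Some (j, m) \<Rightarrow> X \<inter> f j ` {of_int m..of_int m + 1})" for i :: "(nat \<times> int) option"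
  show ?thesis
  proof (rule hausdorff1_null_countable_UN[of UNIV S])
    show "hausdorff1 (S i) = 0" for i
      using null' f(2) by (auto simp: S_def split: option.split)
    show "X \<subseteq> (\<Union>i. S i)"
    proof
      fix x assume "x \<in> X"
      show "x \<in> (\<Union>i. S i)"
      proof (cases "x \<in> (\<Union>j. range (f j))")
        case True
        then obtain j t where "x = f j t" by blast
        moreover have "t \<in> {of_int \<lfloor>t\<rfloor>..of_int \<lfloor>t\<rfloor> + 1}" by simp
        ultimately have "x \<in> S (Some (j, \<lfloor>t\<rfloor>))" using \<open>x \<in> X\<close> by (auto simp: S_def)
        then show ?thesis by blast
      next
        case False
        then have "x \<in> S None" using \<open>x \<in> X\<close> rect(2) by (auto simp: S_def)
        then show ?thesis by blast
      qed
    qed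
  qed simp
qed

section \<open>Admissible tuples, bad parameters and affine independence\<close>

lemma hausdorff1_null_if_admissible:
  fixes E :: "(real^'d) set" and \<alpha> :: "'d \<Rightarrow> 'a"
  assumes "rectifiable1 E" and C1: "\<And>i. C1_on UNIV (\<phi> (\<alpha> i))"
    and null: "\<And>i. hausdorff1 (\<phi> (\<alpha> i) ` E) = 0" and "admissible \<phi> \<alpha>"
  shows "hausdorff1 E = 0"
proof -
  obtain M where M: "C1_submanifold (CARD('d) - 1) M" "critical_set \<phi> \<alpha> \<subseteq> M"
    "\<And>x. x \<in> M \<Longrightarrow> dim (frechet_derivative (tuple_map \<phi> \<alpha>) (at x) ` tangent_space M x) = CARD('d) - 1"
    using assms(4) unfolding admissible_def by blast
  define H where "H = tuple_map \<phi> \<alpha>"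
  have H: "C1_on UNIV H"
    using C1_on_vec_lambda[OF C1] unfolding H_def tuple_map_def .
  have D: "(H has_derivative frechet_derivative H (at x)) (at x)" for x
  proof -
    obtain D where "(H has_derivative D) (at x)" using H unfolding C1_on_def by blast
    then have "H differentiable (at x)" by (rule differentiableI)
    then show ?thesis by (simp add: frechet_derivative_works)
  qed
  have proj: "hausdorff1 ((\<lambda>x. H x $ i) ` X) = 0" if "X \<subseteq> E" for X i
    by (rule hausdorff1_null_subset[OF null[of i]]) (use that in \<open>auto simp: H_def tuple_map_def\<close>)
  \<comment> \<open>At points of \<open>M\<close> the derivative may degenerate transversally, so
    only pairs of points inside \<open>M\<close> are compared.\<close>
  have "hausdorff1 (E \<inter> M) = 0"
  proof (rule hausdorff1_null_local)
    fix x assume "x \<in> E \<inter> M"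
    then have "x \<in> M" by simp
    then have "CARD('d) - 1 \<le> dim (frechet_derivative H (at x) ` tangent_space M x)"
      by (simp add: H_def M(3))
    from submanifold_expanding[OF H M(1) \<open>x \<in> M\<close> D this]
    obtain c r where "c > 0" "r > 0"
      "\<And>y z. y \<in> M \<inter> ball x r \<Longrightarrow> z \<in> M \<inter> ball x r \<Longrightarrow> c * dist y z \<le> dist (H y) (H z)"
      by blast
    then have "hausdorff1 (E \<inter> M \<inter> ball x r) = 0"
      by (intro hausdorff1_null_of_expanding_projections[OF assms(1) _ H proj]) auto
    with \<open>r > 0\<close> show "\<exists>r>0. hausdorff1 (E \<inter> M \<inter> ball x r) = 0" by blast
  qed
  moreover have "hausdorff1 (E - M) = 0"
  proof (rule hausdorff1_null_local)
    fix x assume x: "x \<in> E - M"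
    then have "x \<notin> critical_set \<phi> \<alpha>" using M(2) by blast
    \<comment> \<open>Off the critical set the rank exceeds \<open>CARD('d) - 1\<close>, so it is
      full and expansion holds with \<open>UNIV\<close> as the subspace. The resulting ball may meet
      \<open>M\<close>, which need not be closed; the estimate is valid on all of it.\<close>
    then have "dim (UNIV :: (real^'d) set) \<le> dim (range (frechet_derivative H (at x)))"
      by (simp add: critical_set_def H_def)
    note inj = linear_injective_on_subspace_if_dim_image[OF has_derivative_linear[OF D] subspace_UNIV this]
    show "\<exists>r>0. hausdorff1 ((E - M) \<inter> ball x r) = 0"
    proof (rule C1_on_expanding[OF open_UNIV H UNIV_I D subspace_UNIV inj])
      fix c r assume "c > 0" "r > 0"
        "\<And>y z. y \<in> ball x r \<Longrightarrow> z \<in> ball x r \<Longrightarrow> y - z \<in> UNIV \<Longrightarrow> c * dist y z \<le> dist (H y) (H z)"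
      then have "hausdorff1 ((E - M) \<inter> ball x r) = 0"
        by (intro hausdorff1_null_of_expanding_projections[OF assms(1) _ H proj]) auto
      with \<open>r > 0\<close> show ?thesis by blast
    qed
  qed
  ultimately have null: "hausdorff1 (if b then E \<inter> M else E - M) = 0" for b
    by simp
  have "E \<subseteq> (\<Union>b. if b then E \<inter> M else E - M)"
    by (auto simp: UNIV_bool)
  then show ?thesis
    by (rule hausdorff1_null_countable_UN[OF countable_finite[OF finite] null])
qed

text \<open>An affine basis of \<open>B\<close> has \<open>aff_dim B + 1\<close> elements;
  \<open>CARD('d)\<close> of them are selected and labelled bijectively by the coordinates.\<close>

lemma ex_affinely_independent_tuple:
  fixes B :: "'b::euclidean_space set"
  assumes "int CARD('d) \<le> aff_dim B + 1"
  obtains \<alpha> :: "'d::finite \<Rightarrow> 'b" where "\<alpha> \<in> UNIV \<rightarrow> B" "affinely_independent_tuple \<alpha>"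
proof -
  obtain C where C: "C \<subseteq> B" "\<not> affine_dependent C" "affine hull B = affine hull C"
    using affine_basis_exists[of B] by blast
  have "finite C" using C(2) by (rule aff_independent_finite)
  have "aff_dim B = int (card C) - 1"
    using aff_dim_affine_independent[OF C(2)] aff_dim_affine_hull[of B] aff_dim_affine_hull[of C] C(3) by simp
  then have "CARD('d) \<le> card C" using assms by simp
  then obtain C' where C': "C' \<subseteq> C" "card C' = CARD('d)" by (rule obtain_subset_with_card_n)
  then obtain \<alpha> where \<alpha>: "bij_betw \<alpha> (UNIV :: 'd set) C'"
    using finite_same_card_bij[of "UNIV :: 'd set" C'] \<open>finite C\<close> finite_subset by auto
  show thesis
  proof
    show "\<alpha> \<in> UNIV \<rightarrow> B" using \<alpha> C' C(1) by (auto simp: bij_betw_def)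
    show "affinely_independent_tuple \<alpha>"
      using \<alpha> affine_independent_subset[OF C(2) C'(1)]
      by (simp add: affinely_independent_tuple_def bij_betw_def)
  qed
qed

text \<open>The common core of both assertions: an admissible tuple of bad parameters contradicts
  the positive measure of \<open>E\<close>.\<close>

lemma hausdorff1_null_if_bad_admissible:
  fixes E :: "(real^'d) set"
  assumes "rectifiable1 E" and C2: "\<forall>\<alpha>\<in>A. C2_on UNIV (\<phi> \<alpha>)"
    and bad: "\<alpha> \<in> UNIV \<rightarrow> bad_params A \<phi> E" and adm: "\<alpha> \<in> admissible_tuples A \<phi>"
  shows "hausdorff1 E = 0"
proof (rule hausdorff1_null_if_admissible[OF assms(1)])
  have "\<alpha> i \<in> bad_params A \<phi> E" for i using bad by (rule funcset_mem) simp
  then have A: "\<alpha> i \<in> A" "hausdorff1 (\<phi> (\<alpha> i) ` E) = 0" for i by (simp_all add: bad_params_def)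
  show "hausdorff1 (\<phi> (\<alpha> i) ` E) = 0" "C1_on UNIV (\<phi> (\<alpha> i))" for i
    using A C2 by (auto intro: C2_on_imp_C1_on)
  show "admissible \<phi> \<alpha>" using adm by (simp add: admissible_tuples_def)
qed

theorem proposition4p7:
  fixes E :: "(real^'d) set"
  assumes "CARD('d) \<ge> 2"
    and "E \<in> sets borel"
    and "rectifiable1 E"
    and "hausdorff1 E > 0"
  shows "(\<forall>(T :: 'a topology) (\<phi> :: 'a \<Rightarrow> real^'d \<Rightarrow> real).
            (\<forall>\<alpha>\<in>topspace T. C2_on UNIV (\<phi> \<alpha>)) \<longrightarrow>
            (UNIV \<rightarrow> bad_params (topspace T) \<phi> E) \<inter> admissible_tuples (topspace T) \<phi> = {})
       \<and> (\<forall>(A :: (real^'m) set) (\<phi> :: real^'m \<Rightarrow> real^'d \<Rightarrow> real).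
            (\<forall>\<alpha>\<in>A. C2_on UNIV (\<phi> \<alpha>)) \<longrightarrow>
            (\<forall>\<alpha> \<in> UNIV \<rightarrow> A. affinely_independent_tuple \<alpha> \<longrightarrow> \<alpha> \<in> admissible_tuples A \<phi>) \<longrightarrow>
            (\<exists>V. affine V \<and> V \<noteq> {} \<and> bad_params A \<phi> E \<subseteq> V \<and> aff_dim V \<le> int CARD('d) - 2))"
proof (intro conjI allI impI)
  fix T :: "'a topology" and \<phi> :: "'a \<Rightarrow> real^'d \<Rightarrow> real"
  assume "\<forall>\<alpha>\<in>topspace T. C2_on UNIV (\<phi> \<alpha>)"
  then show "(UNIV \<rightarrow> bad_params (topspace T) \<phi> E) \<inter> admissible_tuples (topspace T) \<phi> = {}"
    using hausdorff1_null_if_bad_admissible[OF assms(3)] assms(4) by (metis disjoint_iff less_irrefl)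
next
  fix A :: "(real^'m) set" and \<phi> :: "real^'m \<Rightarrow> real^'d \<Rightarrow> real"
  assume C2: "\<forall>\<alpha>\<in>A. C2_on UNIV (\<phi> \<alpha>)"
    and adm: "\<forall>\<alpha> \<in> UNIV \<rightarrow> A. affinely_independent_tuple \<alpha> \<longrightarrow> \<alpha> \<in> admissible_tuples A \<phi>"
  let ?B = "bad_params A \<phi> E"
  \<comment> \<open>If the dimension were larger, the bad parameters would contain an affinely
    independent \<open>CARD('d)\<close>-tuple, which is admissible by assumption.\<close>
  have dim: "aff_dim ?B \<le> int CARD('d) - 2"
  proof (rule ccontr)
    assume "\<not> aff_dim ?B \<le> int CARD('d) - 2"
    then have "int CARD('d) \<le> aff_dim ?B + 1" by simp
    then obtain \<alpha> :: "'d \<Rightarrow> real^'m" where \<alpha>: "\<alpha> \<in> UNIV \<rightarrow> ?B" "affinely_independent_tuple \<alpha>"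
      by (rule ex_affinely_independent_tuple)
    then have "\<alpha> \<in> UNIV \<rightarrow> A" by (auto simp: bad_params_def)
    with \<alpha> adm have "\<alpha> \<in> admissible_tuples A \<phi>" by blast
    with hausdorff1_null_if_bad_admissible[OF assms(3) C2 \<alpha>(1)] assms(4) show False by simp
  qed
  show "\<exists>V. affine V \<and> V \<noteq> {} \<and> ?B \<subseteq> V \<and> aff_dim V \<le> int CARD('d) - 2"
  proof (cases "?B = {}")
    \<comment> \<open>The affine hull of the empty set is empty, so a point is used instead; its
      dimension 0 is allowed because \<open>CARD('d)\<close> is at least 2.\<close>
    case True
    then show ?thesis using assms(1) by (intro exI[of _ "{0}"]) auto
  next
    case False
    then show ?thesis using dim by (intro exI[of _ "affine hull ?B"]) (auto simp: hull_subset)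
  qed
qed

end
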